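(* Let $K$ be a field, $S=K[x_1,\ldots,x_n]$, and let $I\subset S$ be a squarefree complete intersection monomial ideal, minimally generated by the monomials $u_1,\ldots,u_m\in S$. Let $d_i=\deg(u_i)$, $1\leq i\leq m$, and assume that there exists some $k\geq 0$ such that $$1=d_1=d_2=\cdots=d_k<d_{k+1}\leq d_{k+2}\leq\cdots\leq d_m.$$ Let $n'=d_{k+1}+d_{k+2}+\cdots+d_m$. Then $$\operatorname{slength}(I)\leq k+\binom{n'+1}{\left\lfloor\frac{m-k}{2}\right\rfloor}.$$ In particular, if $k=0$ and $n'=n$, then $\operatorname{slength}(I)\leq\binom{n+1}{\left\lfloor\frac m2\right\rfloor}$.
   Context: Let $M$ be a finitely generated $\mathbb Z^n$-graded $S$-module, $S=K[x_1,\ldots,x_n]$. A Stanley decomposition of $M$ is a finite direct sum of $K$-vector spaces $\mathcal D: M=\bigoplus_{i=1}^r m_iK[Z_i]$, where each $m_i\in M$ is homogeneous, $Z_i\subset\{x_1,\ldots,x_n\}$, and $m_iK[Z_i]$ is a free $K[Z_i]$-module. Its length is $\operatorname{slength}(\mathcal D)=r$, and the Stanley length of $M$ is $\operatorname{slength}(M)=\min\{\operatorname{slength}(\mathcal D):\mathcal D\text{ is a Stanley decomposition of }M\}$. A monomial ideal is a complete intersection if its minimal monomial generators form a regular sequence, equivalently they are pairwise coprime nonunit monomials; it is squarefree if its minimal generators are squarefree monomials. *)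

theory Defs
  imports
    Complex_Main
    "HOL-Library.Cardinality"
    "HOL-Library.Poly_Mapping"
    "HOL-Computational_Algebra.Squarefree"
begin

section \<open>The polynomial ring\<close>

text \<open>\<open>('n, 'k) mpoly\<close> is the polynomial ring over \<open>'k\<close> whose variables are the elements of the
  finite type \<open>'n\<close>: the monoid ring of the exponent vectors \<open>'n \<Rightarrow>\<^sub>0 nat\<close>, with the
  convolution product of \<^theory>\<open>HOL-Library.Poly_Mapping\<close>.\<close>

type_synonym ('n, 'k) mpoly = "('n \<Rightarrow>\<^sub>0 nat) \<Rightarrow>\<^sub>0 'k"

definition monomials :: "('n, 'k::field) mpoly set"
  where "monomials = range (\<lambda>b. Poly_Mapping.single b 1)"

text \<open>The value 0 for the zero polynomial is a convention.\<close>

definition total_degree :: "('n::finite, 'k::field) mpoly \<Rightarrow> nat"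
  where "total_degree f =
    Max (insert 0 ((\<lambda>b. \<Sum>i\<in>UNIV. Poly_Mapping.lookup b i) ` Poly_Mapping.keys f))"

definition polys_in :: "'n set \<Rightarrow> ('n, 'k::field) mpoly set"  (\<open>K[_]\<close>)
  where "K[Z] = {f. \<forall>b\<in>Poly_Mapping.keys f. Poly_Mapping.keys b \<subseteq> Z}"

abbreviation ideal :: "('n, 'k::field) mpoly set \<Rightarrow> ('n, 'k) mpoly set"
  where "ideal \<equiv> module.span (*)"

interpretation poly_module: module "(*) :: ('n, 'k::field) mpoly \<Rightarrow> _"
  by standard (simp_all add: algebra_simps)


section \<open>Graded modules\<close>

definition zdeg :: "('n \<Rightarrow>\<^sub>0 nat) \<Rightarrow> ('n \<Rightarrow>\<^sub>0 int)"
  where "zdeg b = Poly_Mapping.map int b"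

text \<open>\<open>V\<close> is the internal direct sum of its subgroups \<open>A i\<close>, \<open>i \<in> J\<close>: every element of \<open>V\<close> arises from
  exactly one finitely supported family.\<close>

definition direct_sum_of :: "'i set \<Rightarrow> ('i \<Rightarrow> 'm::ab_group_add set) \<Rightarrow> 'm set \<Rightarrow> bool"
  where "direct_sum_of J A V \<longleftrightarrow>
    bij_betw (\<lambda>y. \<Sum>i | y i \<noteq> 0. y i)
      {y. (\<forall>i\<in>J. y i \<in> A i) \<and> (\<forall>i. i \<notin> J \<longrightarrow> y i = 0) \<and> finite {i. y i \<noteq> 0}} V"

text \<open>A finitely generated module \<open>M\<close> over the polynomial ring, graded by \<open>'n \<Rightarrow>\<^sub>0 int\<close>;
  \<open>comp a\<close> is the homogeneous component of degree \<open>a\<close>. The carrier \<open>M\<close> is a submodule of an ambient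
  type, so that ideals are covered.\<close>

locale graded_module = module scale
  for scale :: "('n::finite, 'k::field) mpoly \<Rightarrow> 'm::ab_group_add \<Rightarrow> 'm"  (infixr \<open>*s\<close> 75) +
  fixes M :: "'m set" and comp :: "('n \<Rightarrow>\<^sub>0 int) \<Rightarrow> 'm set"
  assumes submodule: "subspace M"
    and finitely_generated: "\<exists>G. finite G \<and> span G = M"
    and comp_zero: "0 \<in> comp a"
    and comp_add: "v \<in> comp a \<Longrightarrow> w \<in> comp a \<Longrightarrow> v + w \<in> comp a"
    and comp_scale: "v \<in> comp a \<Longrightarrow> Poly_Mapping.single b c *s v \<in> comp (zdeg b + a)"
    and comp_direct_sum: "direct_sum_of UNIV comp M"
begin

definition stanley_space :: "'m \<Rightarrow> 'n set \<Rightarrow> 'm set"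
  where "stanley_space v Z = (\<lambda>f. f *s v) ` K[Z]"

text \<open>Injectivity of multiplication by \<open>v\<close> on \<open>K[Z]\<close> says that \<open>v K[Z]\<close> is free with basis \<open>v\<close>. In
  particular \<open>v\<close> is nonzero, so the zero module contributes no summands.\<close>

definition stanley_decomposition :: "('m \<times> 'n set) list \<Rightarrow> bool"
  where "stanley_decomposition D \<longleftrightarrow>
    (\<forall>(v, Z) \<in> set D. v \<in> M \<and> (\<exists>a. v \<in> comp a) \<and> inj_on (\<lambda>f. f *s v) K[Z]) \<and>
    direct_sum_of {..<length D} (\<lambda>i. stanley_space (fst (D ! i)) (snd (D ! i))) M"

definition slength :: nat
  where "slength = (LEAST r. \<exists>D. stanley_decomposition D \<and> length D = r)"

end


section \<open>Monomial ideals\<close>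

definition graded_part :: "('n, 'k::field) mpoly set \<Rightarrow> ('n \<Rightarrow>\<^sub>0 int) \<Rightarrow> ('n, 'k) mpoly set"
  where "graded_part I a = {f \<in> I. \<forall>b\<in>Poly_Mapping.keys f. zdeg b = a}"

definition ideal_slength :: "('n::finite, 'k::field) mpoly set \<Rightarrow> nat"
  where "ideal_slength I = graded_module.slength (*) I (graded_part I)"

definition minimal_monomial_generators :: "('n, 'k::field) mpoly set \<Rightarrow> ('n, 'k) mpoly set \<Rightarrow> bool"
  where "minimal_monomial_generators U I \<longleftrightarrow>
    U \<subseteq> monomials \<and> ideal U = I \<and> (\<forall>V. V \<subset> U \<longrightarrow> ideal V \<noteq> I)"

definition regular_sequence :: "('n, 'k::field) mpoly list \<Rightarrow> bool"
  where "regular_sequence us \<longleftrightarrow>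
    (\<forall>i<length us. \<forall>f. us ! i * f \<in> ideal (set (take i us)) \<longrightarrow> f \<in> ideal (set (take i us))) \<and>
    ideal (set us) \<noteq> UNIV"

definition complete_intersection_monomial_ideal :: "('n, 'k::field) mpoly set \<Rightarrow> bool"
  where "complete_intersection_monomial_ideal I \<longleftrightarrow>
    (\<exists>us. distinct us \<and> minimal_monomial_generators (set us) I \<and> regular_sequence us)"

definition squarefree_monomial_ideal :: "('n, 'k::field) mpoly set \<Rightarrow> bool"
  where "squarefree_monomial_ideal I \<longleftrightarrow>
    (\<exists>U. minimal_monomial_generators U I \<and> (\<forall>u\<in>U. squarefree u))"


section \<open>Monomial ideals are graded modules\<close>

lemma lookup_zdeg [simp]: "Poly_Mapping.lookup (zdeg b) i = int (Poly_Mapping.lookup b i)"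
  by (simp add: zdeg_def Poly_Mapping.map.rep_eq when_def)

lemma zdeg_eq_iff [simp]: "zdeg b = zdeg c \<longleftrightarrow> b = c"
  by (auto simp: poly_mapping_eq_iff fun_eq_iff)

lemma zdeg_add: "zdeg (b + c) = zdeg b + zdeg c"
  by (auto simp: poly_mapping_eq_iff fun_eq_iff lookup_add)

lemma poly_eq_sum_single:
  fixes f :: "('n, 'k::field) mpoly"
  shows "f = (\<Sum>b\<in>Poly_Mapping.keys f. Poly_Mapping.single b (Poly_Mapping.lookup f b))"
  by (rule poly_mapping_eqI)
    (auto simp: lookup_sum lookup_single when_def in_keys_iff)

lemma single_in_monomial_ideal:
  fixes U :: "('n, 'k::field) mpoly set"
  assumes "U \<subseteq> monomials" and "f \<in> ideal U"
  shows "Poly_Mapping.single b (Poly_Mapping.lookup f b) \<in> ideal U"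
  using assms(2)
proof (induction rule: poly_module.span_induct_alt)
  case base
  show ?case by (simp add: poly_module.span_zero)
next
  case (step c x y)
  obtain e where x: "x = Poly_Mapping.single e 1"
    using step(1) assms(1) by (auto simp: monomials_def)
  have cx: "c * x = (\<Sum>d\<in>Poly_Mapping.keys c. Poly_Mapping.single (d + e) (Poly_Mapping.lookup c d))"
    unfolding x by (subst poly_eq_sum_single[of c]) (simp add: sum_distrib_right mult_single)
  have "Poly_Mapping.single b (Poly_Mapping.lookup (c * x) b) =
      (\<Sum>d\<in>Poly_Mapping.keys c. Poly_Mapping.single b (Poly_Mapping.lookup c d when d + e = b))"
    by (rule poly_mapping_eqI) (auto simp: cx lookup_sum lookup_single when_def)
  also have "\<dots> = (\<Sum>d\<in>Poly_Mapping.keys c. Poly_Mapping.single d (Poly_Mapping.lookup c d when d + e = b) * x)"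
    by (intro sum.cong) (auto simp: x mult_single when_def)
  also have "\<dots> \<in> ideal U"
    using step(1) by (intro poly_module.span_sum poly_module.span_scale poly_module.span_base)
  finally show ?case
    using step(2) by (simp add: lookup_add single_add poly_module.span_add)
qed

lemma monomial_ideal_direct_sum:
  fixes U :: "('n, 'k::field) mpoly set"
  assumes "U \<subseteq> monomials"
  shows "direct_sum_of UNIV (graded_part (ideal U)) (ideal U)"
proof -
  let ?I = "ideal U"
  define Y where "Y = {y. (\<forall>a. y a \<in> graded_part ?I a) \<and> finite {a. y a \<noteq> 0}}"
  define S :: "_ \<Rightarrow> ('n, 'k) mpoly" where "S y = (\<Sum>a | y a \<noteq> 0. y a)" for y :: "('n \<Rightarrow>\<^sub>0 int) \<Rightarrow> _"
  have off: "Poly_Mapping.lookup (y a) b = 0" if "y \<in> Y" "a \<noteq> zdeg b" for y a b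
  proof -
    have "\<forall>e\<in>Poly_Mapping.keys (y a). zdeg e = a"
      using that(1) by (simp add: Y_def graded_part_def)
    then show ?thesis
      using that(2) by (cases "b \<in> Poly_Mapping.keys (y a)") (auto simp: in_keys_iff)
  qed
  have S: "Poly_Mapping.lookup (S y) b = Poly_Mapping.lookup (y (zdeg b)) b" if "y \<in> Y" for y b
  proof -
    have "Poly_Mapping.lookup (S y) b = (\<Sum>a | y a \<noteq> 0. Poly_Mapping.lookup (y a) b)"
      by (simp add: S_def lookup_sum)
    also have "\<dots> = (\<Sum>a | y a \<noteq> 0. if a = zdeg b then Poly_Mapping.lookup (y a) b else 0)"
      by (intro sum.cong) (auto simp: off[OF that])
    also have "\<dots> = Poly_Mapping.lookup (y (zdeg b)) b"
    proof -
      have "finite {a. y a \<noteq> 0}"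
        using that by (simp add: Y_def)
      then show ?thesis by (simp add: sum.delta)
    qed
    finally show ?thesis .
  qed
  have "inj_on S Y"
  proof (rule inj_onI)
    fix y z assume yz: "y \<in> Y" "z \<in> Y" "S y = S z"
    show "y = z"
    proof
      fix a
      show "y a = z a"
      proof (rule poly_mapping_eqI)
        fix b
        show "Poly_Mapping.lookup (y a) b = Poly_Mapping.lookup (z a) b"
          by (cases "a = zdeg b") (metis S yz, simp add: off yz)
      qed
    qed
  qed
  moreover have "S y \<in> ?I" if "y \<in> Y" for y
    unfolding S_def
  proof (rule poly_module.span_sum)
    show "y a \<in> ?I" for a
      using that by (simp add: Y_def graded_part_def)
  qed
  moreover have "?I \<subseteq> S ` Y"
  proof
    fix f assume f: "f \<in> ?I"
    define y where "y a =
      (\<Sum>b | b \<in> Poly_Mapping.keys f \<and> zdeg b = a. Poly_Mapping.single b (Poly_Mapping.lookup f b))" for a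
    have ly: "Poly_Mapping.lookup (y a) b = (if zdeg b = a then Poly_Mapping.lookup f b else 0)" for a b
      by (auto simp: y_def lookup_sum lookup_single when_def in_keys_iff)
    have "{a. y a \<noteq> 0} \<subseteq> zdeg ` Poly_Mapping.keys f"
    proof
      fix a assume "a \<in> {a. y a \<noteq> 0}"
      then obtain b where "Poly_Mapping.lookup (y a) b \<noteq> 0"
        by (metis (mono_tags) mem_Collect_eq poly_mapping_eqI lookup_zero)
      then show "a \<in> zdeg ` Poly_Mapping.keys f"
        by (auto simp: ly in_keys_iff split: if_splits)
    qed
    then have "finite {a. y a \<noteq> 0}"
      by (rule finite_subset) simp
    moreover have "y a \<in> graded_part ?I a" for a
    proof -
      have "y a \<in> ?I"
        unfolding y_def by (intro poly_module.span_sum single_in_monomial_ideal assms f)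
      then show ?thesis
        by (auto simp: graded_part_def in_keys_iff ly split: if_splits)
    qed
    ultimately have y: "y \<in> Y" by (simp add: Y_def)
    then have "f = S y"
      by (intro poly_mapping_eqI) (simp add: S ly)
    with y show "f \<in> S ` Y" by blast
  qed
  ultimately have "bij_betw S Y ?I"
    unfolding bij_betw_def by blast
  then show ?thesis
    by (simp add: direct_sum_of_def S_def[abs_def] Y_def)
qed

lemma graded_module_monomial_ideal:
  fixes U :: "('n::finite, 'k::field) mpoly set"
  assumes "U \<subseteq> monomials" and "finite U"
  shows "graded_module (*) (ideal U) (graded_part (ideal U))"
proof
  show "poly_module.subspace (ideal U)" by simp
  show "\<exists>G. finite G \<and> ideal G = ideal U" using assms(2) by blast
  show "direct_sum_of UNIV (graded_part (ideal U)) (ideal U)"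
    by (rule monomial_ideal_direct_sum[OF assms(1)])
next
  fix a
  show "0 \<in> graded_part (ideal U) a" by (simp add: graded_part_def poly_module.span_zero)
next
  fix v w a assume "v \<in> graded_part (ideal U) a" "w \<in> graded_part (ideal U) a"
  then show "v + w \<in> graded_part (ideal U) a"
    using keys_add[of v w] by (auto simp: graded_part_def intro: poly_module.span_add)
next
  fix v a b and c :: 'k assume "v \<in> graded_part (ideal U) a"
  then show "Poly_Mapping.single b c * v \<in> graded_part (ideal U) (zdeg b + a)"
    using keys_mult[of "Poly_Mapping.single b c" v]
    by (fastforce simp: graded_part_def zdeg_add poly_module.span_zero
        intro!: poly_module.span_scale split: if_splits)
qed

end

theory Submission
  imports Defs "HOL-Library.Disjoint_Sets"
begin

text \<open>The generators \<open>u\<^sub>i\<close> are the products over disjoint blocks \<open>A\<^sub>i\<close> of variables. To an exponent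
  vector associate the binary word recording which \<open>u\<^sub>i\<close> divide the monomial; the ideal consists of
  the nonzero words. For odd \<open>m\<close>, every nonzero cyclic word of length \<open>m\<close> has a unique tiling
  by the tiles \<open>1\<close> and \<open>0*\<close>, where \<open>*\<close> is an arbitrary letter. As the monomials not divisible by
  \<open>u\<^sub>i\<close> split into \<open>d\<^sub>i\<close> free pieces, each tiling contributes the product of the \<open>d\<^sub>i\<close> over
  the first positions of its two-letter tiles, and the total is bounded by the Vandermonde convolution.
  For even \<open>m\<close>, and for the generators of degree 1, split off one generator \<open>u\<close> by
  \<open>(u) + J = (u) \<oplus> J \<inter> \<langle>monomials not divisible by u\<rangle>\<close>.\<close>

section \<open>Tilings of cyclic words\<close>

text \<open>The next letter forces whether the next tile is \<open>1\<close> or \<open>0*\<close>,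
  so a linear word has at most one tiling; it has none exactly when a \<open>0\<close> is left
  without a partner.\<close>

fun tileable :: "bool list \<Rightarrow> bool" where
  "tileable [] = True"
| "tileable [x] = x"
| "tileable (x # y # zs) = (if x then tileable (y # zs) else tileable zs)"

lemma tileable_Cons_True [simp]: "tileable (True # xs) = tileable xs"
  by (cases xs) auto

lemma tileable_snoc_True: "tileable (xs @ [True])"
  by (induction xs rule: tileable.induct) auto

text \<open>The reading of \<open>xs\<close> from the left either uses it up, and then the new
  \<open>0\<close> lacks a partner, or leaves a final \<open>0\<close> open, and then the new letter
  completes its tile.\<close>

lemma tileable_snoc_False: "tileable (xs @ [False]) \<longleftrightarrow> \<not> tileable xs"
  by (induction xs rule: tileable.induct) auto

text \<open>Tiles of length two alone cannot fill an odd length.\<close>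

lemma tileable_odd_imp_True: "tileable xs \<Longrightarrow> odd (length xs) \<Longrightarrow> True \<in> set xs"
  by (induction xs rule: tileable.induct) (auto split: if_splits)

text \<open>The readings that start at the first and at the second letter both have a tile boundary
  just behind the first \<open>1\<close>: one meets it as a tile of its own, the other may cover it
  by \<open>0*\<close>. From there on they agree.\<close>

lemma tileable_drop_first:
  "odd (length ys) \<Longrightarrow> True \<in> set (x # ys) \<Longrightarrow> tileable (x # ys) = tileable ys"
proof (induction ys arbitrary: x rule: length_induct)
  case (1 ys)
  then obtain y zs where ys: "ys = y # zs" by (cases ys) auto
  show ?case
  proof (cases "x \<or> y \<or> zs = []")
    case True
    then show ?thesis using 1(3) by (auto simp: ys)
  next
    case False
    then obtain z zs' where zs: "zs = z # zs'" by (cases zs) auto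
    have "tileable (z # zs') = tileable zs'"
      using 1 False by (intro 1(1)[rule_format]) (auto simp: ys zs)
    then show ?thesis using False by (simp add: ys zs)
  qed
qed

text \<open>The second alternative is the tile that wraps around: it starts at the last letter and covers
  the first one.\<close>

lemma cyclic_tiling:
  assumes "odd (length ys)"
  shows "True \<in> set (x # ys @ [z]) \<longleftrightarrow> tileable (x # ys @ [z]) \<or> \<not> z \<and> tileable ys"
    and "\<not> (tileable (x # ys @ [z]) \<and> \<not> z \<and> tileable ys)"
proof -
  have *: "tileable (x # ys @ [z]) = (z \<or> \<not> tileable (x # ys))"
    using tileable_snoc_True[of "x # ys"] tileable_snoc_False[of "x # ys"] by (cases z) auto
  have "tileable ys \<Longrightarrow> True \<in> set ys"
    using tileable_odd_imp_True assms by blast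
  \<comment> \<open>If \<open>z\<close> is \<open>0\<close> and the word is nonzero, a
    \<open>1\<close> lies in \<open>x # ys\<close>. By \<open>*\<close> the straight tiling then
    exists iff \<open>ys\<close> is not tileable, so exactly one of the two alternatives
    occurs.\<close>
  moreover have "tileable (x # ys) = tileable ys" if "True \<in> set (x # ys)"
    using tileable_drop_first assms that by blast
  moreover have "True \<in> set (x # ys @ [z])" if "tileable (x # ys @ [z])"
    using tileable_odd_imp_True[OF that] assms by simp
  ultimately show "True \<in> set (x # ys @ [z]) \<longleftrightarrow> tileable (x # ys @ [z]) \<or> \<not> z \<and> tileable ys"
    and "\<not> (tileable (x # ys @ [z]) \<and> \<not> z \<and> tileable ys)"
    using * by auto
qed

text \<open>The sum, over all ways to cut the list into pieces of length one and two, of the product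
  of the first entries of the two-entry pieces. A tile \<open>0*\<close> at a block of
  \<open>a\<close> variables counts \<open>a\<close>, as the monomials not divisible by the block's
  product form \<open>a\<close> cylinders. The last entry starts no such tile.\<close>

fun tiling_weight :: "nat list \<Rightarrow> nat" where
  "tiling_weight [] = 1"
| "tiling_weight [a] = 1"
| "tiling_weight (a # b # cs) = tiling_weight (b # cs) + a * tiling_weight cs"

lemma tiling_weight_Cons_ge: "tiling_weight cs \<le> tiling_weight (c # cs)"
  by (cases cs) auto

text \<open>Pascal's rule is applied \<open>a\<close> times, each time gaining at least
  \<open>x choose h\<close>. The left side consists of two terms of the Vandermonde sum.\<close>

lemma binomial_add_ge: "(x choose Suc h) + a * (x choose h) \<le> (x + a) choose Suc h"
proof (induction a)
  case (Suc a)
  have "x choose h \<le> (x + a) choose h" by (rule binomial_right_mono) simp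
  with Suc show ?case by simp
qed simp

text \<open>Each induction step strips two entries \<open>a\<close>, \<open>b\<close>, and
  \<open>binomial_add_ge\<close> turns the factor \<open>a + b\<close> into a shift of the upper
  index. The entry \<open>e\<close> starts no two-letter tile, hence is absent on the right.\<close>

lemma tiling_weight_le_binomial:
  assumes "length ds = 2 * h" and "\<forall>a\<in>set ds. 1 \<le> a"
  shows "tiling_weight (ds @ [e]) \<le> (sum_list ds + 1) choose h"
  using assms
proof (induction h arbitrary: ds)
  case (Suc h)
  then obtain a b cs where ds: "ds = a # b # cs"
    by (cases ds; cases "tl ds") auto
  have len: "length cs = 2 * h" using Suc.prems by (simp add: ds)
  have IH: "tiling_weight (cs @ [e]) \<le> (sum_list cs + 1) choose h"
    using Suc.prems len by (intro Suc.IH) (auto simp: ds)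
  obtain c cs' where cs: "cs @ [e] = c # cs'" by (cases "cs @ [e]") auto
  have "tiling_weight (ds @ [e]) \<le> (1 + a + b) * tiling_weight (c # cs')"
    using tiling_weight_Cons_ge[of cs' c] by (simp add: ds cs algebra_simps add_mono)
  also have "\<dots> \<le> (1 + a + b) * ((sum_list cs + 1) choose h)"
    using IH unfolding cs by (rule mult_le_mono2)
  also have "\<dots> \<le> ((sum_list cs + 1) choose Suc h) + (a + b) * ((sum_list cs + 1) choose h)"
  proof -
    \<comment> \<open>As the entries are positive, the upper index is at least
      \<open>2 * h + 1\<close>, so its row does not decrease from \<open>h\<close> to
      \<open>Suc h\<close>; for \<open>sum_list cs = 2 * h\<close> these are the two equal middle
      entries. This absorbs the 1 in \<open>1 + a + b\<close>.\<close>
    have "length cs \<le> sum_list cs"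
      using Suc.prems(2) sum_list_mono[of cs "\<lambda>_. 1" "\<lambda>a. a"] by (simp add: ds sum_list_triv)
    then have "(sum_list cs + 1) choose h \<le> (sum_list cs + 1) choose Suc h"
      using len binomial_mono[of h "Suc h" "sum_list cs + 1"]
        binomial_symmetric[of h "sum_list cs + 1"]
      by (cases "sum_list cs = 2 * h") auto
    then show ?thesis by (simp add: algebra_simps)
  qed
  also have "\<dots> \<le> (sum_list cs + 1 + (a + b)) choose Suc h"
    by (rule binomial_add_ge)
  finally show ?case by (simp add: ds algebra_simps)
qed simp

text \<open>The first summand counts the straight tilings, whose bound does not involve
  \<open>e\<close>; the second counts those with a wrapping tile, of weight \<open>e\<close>. The
  latter fits into the gain from raising the upper index by \<open>e\<close>.\<close>

lemma cyclic_tiling_weight_le_binomial: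
  assumes "length bs = 2 * h + 1" and "\<forall>x\<in>set (a # bs). 1 \<le> x"
  shows "tiling_weight (a # bs @ [e]) + e * tiling_weight bs \<le> (sum_list (a # bs @ [e]) + 1) choose Suc h"
proof -
  obtain cs f where bs: "bs = cs @ [f]" using assms(1) by (cases bs rule: rev_cases) auto
  have "tiling_weight bs \<le> (sum_list cs + 1) choose h"
    unfolding bs using assms by (intro tiling_weight_le_binomial) (auto simp: bs)
  also have "\<dots> \<le> (sum_list (a # bs) + 1) choose h"
    by (rule binomial_right_mono) (simp add: bs)
  finally have "e * tiling_weight bs \<le> e * ((sum_list (a # bs) + 1) choose h)" by simp
  moreover have "tiling_weight (a # bs @ [e]) \<le> (sum_list (a # bs) + 1) choose Suc h"
    using assms tiling_weight_le_binomial[of "a # bs" "Suc h" e] by simp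
  ultimately have "tiling_weight (a # bs @ [e]) + e * tiling_weight bs
      \<le> (sum_list (a # bs) + 1 choose Suc h) + e * (sum_list (a # bs) + 1 choose h)"
    by (intro add_mono)
  also have "\<dots> \<le> (sum_list (a # bs) + 1 + e) choose Suc h"
    by (rule binomial_add_ge)
  also have "sum_list (a # bs) + 1 + e = sum_list (a # bs @ [e]) + 1"
    by simp
  finally show ?thesis .
qed

section \<open>Partitions into cylinders\<close>

text \<open>The exponents of the monomials in x^b K[Z].\<close>

definition cylinder :: "('n \<Rightarrow>\<^sub>0 nat) \<Rightarrow> 'n set \<Rightarrow> ('n \<Rightarrow>\<^sub>0 nat) set"
  where "cylinder b Z = {e. \<forall>i. Poly_Mapping.lookup b i \<le> Poly_Mapping.lookup e i \<and> (i \<notin> Z \<longrightarrow> Poly_Mapping.lookup e i = Poly_Mapping.lookup b i)}"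

text \<open>The set \<open>V\<close> records that membership in \<open>S\<close> depends only on the
  variables in \<open>V\<close>: shifts stay inside \<open>V\<close>, and variables outside are
  free. This makes partitions over disjoint sets of variables independent of each other.\<close>

definition partitionable :: "'n set \<Rightarrow> ('n \<Rightarrow>\<^sub>0 nat) set \<Rightarrow> nat \<Rightarrow> bool"
  where "partitionable V S r \<longleftrightarrow> (\<exists>D. finite D \<and> card D \<le> r \<and>
    (\<forall>(b, Z)\<in>D. Poly_Mapping.keys b \<subseteq> V \<and> - V \<subseteq> Z) \<and>
    disjoint_family_on (\<lambda>(b, Z). cylinder b Z) D \<and> (\<Union>(b, Z)\<in>D. cylinder b Z) = S)"

lemma cylinder_self [simp]: "b \<in> cylinder b Z"
  by (simp add: cylinder_def)

lemma partitionable_mono: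
  "partitionable V S r \<Longrightarrow> V \<subseteq> V' \<Longrightarrow> r \<le> r' \<Longrightarrow> partitionable V' S r'"
  unfolding partitionable_def by (fast intro: order_trans)

lemma partitionable_cylinder: "Poly_Mapping.keys b \<subseteq> V \<Longrightarrow> - V \<subseteq> Z \<Longrightarrow> partitionable V (cylinder b Z) 1"
  unfolding partitionable_def
  by (rule exI[of _ "{(b, Z)}"]) (auto simp: disjoint_family_on_def)

lemma partitionable_empty: "partitionable V {} 0"
  unfolding partitionable_def by (rule exI[of _ "{}"]) (auto simp: disjoint_family_on_def)

lemma partitionable_UNIV: "partitionable V UNIV 1"
  using partitionable_cylinder[of 0 V UNIV] by (simp add: cylinder_def)

lemma partitionable_Un:
  assumes "partitionable V S r" "partitionable V S' r'" "S \<inter> S' = {}"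
  shows "partitionable V (S \<union> S') (r + r')"
proof -
  obtain D where D: "finite D" "card D \<le> r" "\<forall>(b, Z)\<in>D. Poly_Mapping.keys b \<subseteq> V \<and> - V \<subseteq> Z"
    "disjoint_family_on (\<lambda>(b, Z). cylinder b Z) D" "(\<Union>(b, Z)\<in>D. cylinder b Z) = S"
    using assms(1) unfolding partitionable_def by blast
  obtain D' where D': "finite D'" "card D' \<le> r'" "\<forall>(b, Z)\<in>D'. Poly_Mapping.keys b \<subseteq> V \<and> - V \<subseteq> Z"
    "disjoint_family_on (\<lambda>(b, Z). cylinder b Z) D'" "(\<Union>(b, Z)\<in>D'. cylinder b Z) = S'"
    using assms(2) unfolding partitionable_def by blast
  have "disjoint_family_on (\<lambda>(b, Z). cylinder b Z) (D \<union> D')"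
  proof (subst disjoint_family_on_def, intro ballI impI)
    fix p q assume pq: "p \<in> D \<union> D'" "q \<in> D \<union> D'" "p \<noteq> q"
    have S: "case_prod cylinder p \<subseteq> S" if "p \<in> D" for p
      using that unfolding D(5)[symmetric] by (rule UN_upper)
    have S': "case_prod cylinder p \<subseteq> S'" if "p \<in> D'" for p
      using that unfolding D'(5)[symmetric] by (rule UN_upper)
    from pq(1,2) consider "p \<in> D" "q \<in> D" | "p \<in> D" "q \<in> D'" | "p \<in> D'" "q \<in> D" | "p \<in> D'" "q \<in> D'"
      by blast
    then show "case_prod cylinder p \<inter> case_prod cylinder q = {}"
    proof cases
      case 1
      then show ?thesis using disjoint_family_onD[OF D(4)] pq(3) by blast
    next
      case 2
      then show ?thesis using S S' assms(3) by blast
    next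
      case 3
      then show ?thesis using S S' assms(3) by blast
    next
      case 4
      then show ?thesis using disjoint_family_onD[OF D'(4)] pq(3) by blast
    qed
  qed
  moreover have "card (D \<union> D') \<le> r + r'"
    using card_Un_le[of D D'] D(2) D'(2) by linarith
  ultimately show ?thesis
    unfolding partitionable_def using D D' by (intro exI[of _ "D \<union> D'"]) auto
qed

text \<open>At every variable one of the two cylinders imposes no condition, having lower bound 0
  and a free variable there, so the other one decides.\<close>

lemma cylinder_Int:
  assumes "Poly_Mapping.keys b \<subseteq> V" "- V \<subseteq> Z" "Poly_Mapping.keys c \<subseteq> W" "- W \<subseteq> Y" "V \<inter> W = {}"
  shows "cylinder b Z \<inter> cylinder c Y = cylinder (b + c) (Z \<inter> Y)"
proof -
  have *: "Poly_Mapping.lookup c i = 0 \<and> i \<in> Y \<or> Poly_Mapping.lookup b i = 0 \<and> i \<in> Z" for i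
    using assms by (cases "i \<in> V") (auto simp: in_keys_iff subset_iff)
  have "(Poly_Mapping.lookup b i \<le> Poly_Mapping.lookup e i \<and>
        (i \<notin> Z \<longrightarrow> Poly_Mapping.lookup e i = Poly_Mapping.lookup b i)) \<and>
      (Poly_Mapping.lookup c i \<le> Poly_Mapping.lookup e i \<and>
        (i \<notin> Y \<longrightarrow> Poly_Mapping.lookup e i = Poly_Mapping.lookup c i)) \<longleftrightarrow>
      Poly_Mapping.lookup (b + c) i \<le> Poly_Mapping.lookup e i \<and>
        (i \<notin> Z \<inter> Y \<longrightarrow> Poly_Mapping.lookup e i = Poly_Mapping.lookup (b + c) i)" for e i
    using *[of i] by (elim disjE conjE) (simp_all add: lookup_add)
  then have "e \<in> cylinder b Z \<and> e \<in> cylinder c Y \<longleftrightarrow> e \<in> cylinder (b + c) (Z \<inter> Y)" for e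
    unfolding cylinder_def mem_Collect_eq all_conj_distrib[symmetric] by presburger
  then show ?thesis by blast
qed

text \<open>The pairwise intersections of the pieces are again cylinders, so the numbers of pieces
  multiply. This is why the weights of the tiles in one tiling are multiplied.\<close>

lemma partitionable_Int:
  assumes "partitionable V S r" "partitionable W S' r'" "V \<inter> W = {}"
  shows "partitionable (V \<union> W) (S \<inter> S') (r * r')"
proof -
  obtain D where D: "finite D" "card D \<le> r" "\<forall>(b, Z)\<in>D. Poly_Mapping.keys b \<subseteq> V \<and> - V \<subseteq> Z"
    "disjoint_family_on (\<lambda>(b, Z). cylinder b Z) D" "(\<Union>(b, Z)\<in>D. cylinder b Z) = S"
    using assms(1) unfolding partitionable_def by blast
  obtain D' where D': "finite D'" "card D' \<le> r'" "\<forall>(b, Z)\<in>D'. Poly_Mapping.keys b \<subseteq> W \<and> - W \<subseteq> Z"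
    "disjoint_family_on (\<lambda>(b, Z). cylinder b Z) D'" "(\<Union>(b, Z)\<in>D'. cylinder b Z) = S'"
    using assms(2) unfolding partitionable_def by blast
  define F where "F = (\<lambda>((b, Z), (c, Y)). (b + c :: 'a \<Rightarrow>\<^sub>0 nat, Z \<inter> Y :: 'a set))"
  have F: "case_prod cylinder (F (p, q)) = case_prod cylinder p \<inter> case_prod cylinder q"
    if "p \<in> D" "q \<in> D'" for p q
  proof -
    obtain b Z c Y where pq: "p = (b, Z)" "q = (c, Y)" by (cases p, cases q)
    have "Poly_Mapping.keys b \<subseteq> V" "- V \<subseteq> Z" "Poly_Mapping.keys c \<subseteq> W" "- W \<subseteq> Y"
      using that D(3) D'(3) by (auto simp: pq)
    from cylinder_Int[OF this assms(3)] show ?thesis by (simp add: pq F_def)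
  qed
  have "card (F ` (D \<times> D')) \<le> r * r'"
    using card_image_le[of "D \<times> D'" F] D(1,2) D'(1,2) mult_le_mono[OF D(2) D'(2)]
    by (simp add: card_cartesian_product)
  moreover have "\<forall>(b, Z)\<in>F ` (D \<times> D'). Poly_Mapping.keys b \<subseteq> V \<union> W \<and> - (V \<union> W) \<subseteq> Z"
  proof (rule ballI)
    fix x assume "x \<in> F ` (D \<times> D')"
    then obtain p q where x: "x = F (p, q)" "p \<in> D" "q \<in> D'" by blast
    obtain b Z c Y where pq: "p = (b, Z)" "q = (c, Y)" by (cases p, cases q)
    have "Poly_Mapping.keys b \<subseteq> V" "- V \<subseteq> Z" "Poly_Mapping.keys c \<subseteq> W" "- W \<subseteq> Y"
      using x(2,3) D(3) D'(3) by (auto simp: pq)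
    then have "Poly_Mapping.keys (b + c) \<subseteq> V \<union> W \<and> - (V \<union> W) \<subseteq> Z \<inter> Y"
      using keys_add[of b c] by blast
    then show "case x of (b, Z) \<Rightarrow> Poly_Mapping.keys b \<subseteq> V \<union> W \<and> - (V \<union> W) \<subseteq> Z"
      by (simp add: x pq F_def)
  qed
  moreover have "disjoint_family_on (case_prod cylinder) (F ` (D \<times> D'))"
  proof (subst disjoint_family_on_def, intro ballI impI)
    fix x y assume x: "x \<in> F ` (D \<times> D')" and y: "y \<in> F ` (D \<times> D')" and ne: "x \<noteq> y"
    obtain p q where p: "x = F (p, q)" "p \<in> D" "q \<in> D'" using x by blast
    obtain p' q' where p': "y = F (p', q')" "p' \<in> D" "q' \<in> D'" using y by blast
    have "p \<noteq> p' \<or> q \<noteq> q'" using ne p(1) p'(1) by blast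
    then have "case_prod cylinder p \<inter> case_prod cylinder p' = {} \<or>
        case_prod cylinder q \<inter> case_prod cylinder q' = {}"
      using disjoint_family_onD[OF D(4) p(2) p'(2)] disjoint_family_onD[OF D'(4) p(3) p'(3)]
      by blast
    then show "case_prod cylinder x \<inter> case_prod cylinder y = {}"
      unfolding p(1) p'(1) F[OF p(2,3)] F[OF p'(2,3)] by blast
  qed
  moreover have "(\<Union>(b, Z)\<in>F ` (D \<times> D'). cylinder b Z) = S \<inter> S'"
  proof -
    have "(\<Union>x\<in>F ` (D \<times> D'). case_prod cylinder x) =
        (\<Union>(p, q)\<in>D \<times> D'. case_prod cylinder p \<inter> case_prod cylinder q)"
      unfolding image_image
    proof (rule SUP_cong[OF refl])
      fix x assume "x \<in> D \<times> D'"
      then obtain p q where "x = (p, q)" "p \<in> D" "q \<in> D'" by blast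
      then show "case_prod cylinder (F x) = (case x of (p, q) \<Rightarrow> case_prod cylinder p \<inter> case_prod cylinder q)"
        by (simp only: F prod.case)
    qed
    also have "\<dots> = (\<Union>p\<in>D. case_prod cylinder p) \<inter> (\<Union>q\<in>D'. case_prod cylinder q)"
      by blast
    finally show ?thesis unfolding D(5) D'(5) .
  qed
  ultimately show ?thesis
    unfolding partitionable_def using D(1) D'(1) by (intro exI[of _ "F ` (D \<times> D')"]) auto
qed

section \<open>Divisibility by squarefree monomials\<close>

definition multiples :: "'n set \<Rightarrow> ('n \<Rightarrow>\<^sub>0 nat) set"
  where "multiples A = {e. A \<subseteq> Poly_Mapping.keys e}"

lemma partitionable_multiples:
  assumes "finite A"
  shows "partitionable A (multiples A) 1"
proof -
  obtain b :: "'a \<Rightarrow>\<^sub>0 nat" where b: "\<And>i. Poly_Mapping.lookup b i = (if i \<in> A then 1 else 0)"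
  proof
    show "Poly_Mapping.lookup (\<Sum>j\<in>A. Poly_Mapping.single j 1) i = (if i \<in> A then 1 else 0)" for i
      using assms by (simp add: lookup_sum lookup_single when_def)
  qed
  have "multiples A = cylinder b UNIV"
    by (auto simp: multiples_def cylinder_def b in_keys_iff subset_iff Suc_le_eq)
  then show ?thesis
    using partitionable_cylinder[of b A UNIV] b by (simp add: in_keys_iff subset_iff)
qed

text \<open>Order the variables of \<open>A\<close> and sort the monomials by the first one that is
  missing: each class is a single cylinder.\<close>

lemma partitionable_nonmultiples:
  assumes "finite A"
  shows "partitionable A (- multiples A) (card A)"
  using assms
proof (induction A)
  case empty
  then show ?case by (simp add: multiples_def partitionable_empty)
next
  case (insert a A)
  have "- multiples {a} = cylinder 0 (- {a})"
    by (auto simp: multiples_def cylinder_def in_keys_iff)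
  then have "partitionable {a} (- multiples {a}) 1"
    using partitionable_cylinder[of 0 "{a}" "- {a}"] by simp
  then have 1: "partitionable (insert a A) (- multiples {a}) 1"
    by (rule partitionable_mono) auto
  have "partitionable ({a} \<union> A) (multiples {a} \<inter> - multiples A) (1 * card A)"
    using insert by (intro partitionable_Int partitionable_multiples) auto
  then have 2: "partitionable (insert a A) (multiples {a} \<inter> - multiples A) (card A)"
    by simp
  have "- multiples (insert a A) = - multiples {a} \<union> multiples {a} \<inter> - multiples A"
    by (auto simp: multiples_def)
  then show ?case
    using partitionable_Un[OF 1 2] insert by auto
qed

definition tileable_exponents :: "'n set list \<Rightarrow> ('n \<Rightarrow>\<^sub>0 nat) set"
  where "tileable_exponents As = {e. tileable (map (\<lambda>A. A \<subseteq> Poly_Mapping.keys e) As)}"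

abbreviation disjoint_blocks :: "'n set list \<Rightarrow> bool"
  where "disjoint_blocks \<equiv> sorted_wrt (\<lambda>A B. A \<inter> B = {})"

text \<open>The partition follows the recursion of \<open>tileable\<close>: a leading
  \<open>1\<close> gives one cylinder, a leading \<open>0*\<close> gives \<open>card A\<close>
  cylinders and leaves the variables of the second block \<open>B\<close> free.\<close>

lemma partitionable_tileable:
  fixes As :: "'n::finite set list"
  assumes "disjoint_blocks As"
  shows "partitionable (\<Union>(set As)) (tileable_exponents As) (tiling_weight (map card As))"
  using assms
proof (induction As rule: induct_list012)
  case 1
  then show ?case using partitionable_UNIV by (simp add: tileable_exponents_def)
next
  case (2 A)
  then show ?case
    using partitionable_multiples[of A] by (simp add: tileable_exponents_def multiples_def)
next
  case (3 A B Cs)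
  have 1: "partitionable (\<Union>(set (A # B # Cs))) (multiples A \<inter> tileable_exponents (B # Cs))
      (1 * tiling_weight (map card (B # Cs)))"
    by (rule partitionable_mono[OF partitionable_Int[OF partitionable_multiples[of A] 3(2)]])
      (use 3(3) in auto)
  have 2: "partitionable (\<Union>(set (A # B # Cs))) (- multiples A \<inter> tileable_exponents Cs)
      (card A * tiling_weight (map card Cs))"
    by (rule partitionable_mono[OF partitionable_Int[OF partitionable_nonmultiples[of A] 3(1)]])
      (use 3(3) in auto)
  have "tileable_exponents (A # B # Cs) =
      (multiples A \<inter> tileable_exponents (B # Cs)) \<union> (- multiples A \<inter> tileable_exponents Cs)"
    by (auto simp: tileable_exponents_def multiples_def)
  then show ?case using partitionable_Un[OF 1 2] by auto
qed

section \<open>Partitions of the monomials of the ideal\<close>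

definition union_of_multiples :: "'n set list \<Rightarrow> ('n \<Rightarrow>\<^sub>0 nat) set"
  where "union_of_multiples As = (\<Union>A\<in>set As. multiples A)"

text \<open>The principal ideal of the block \<open>A\<close> is a single cylinder; the rest of the
  ideal is cut down to the nonmultiples of \<open>A\<close>, which multiplies its count by
  \<open>card A\<close>.\<close>

lemma partitionable_Cons:
  fixes A :: "'n::finite set"
  assumes "disjoint_blocks (A # As)" and "partitionable (\<Union>(set As)) (union_of_multiples As) r"
  shows "partitionable (\<Union>(set (A # As))) (union_of_multiples (A # As)) (1 + card A * r)"
proof -
  have 1: "partitionable (\<Union>(set (A # As))) (multiples A) 1"
    by (rule partitionable_mono[OF partitionable_multiples]) auto
  have 2: "partitionable (\<Union>(set (A # As))) (- multiples A \<inter> union_of_multiples As) (card A * r)"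
    by (rule partitionable_mono[OF partitionable_Int[OF partitionable_nonmultiples[of A] assms(2)]])
      (use assms(1) in auto)
  have "union_of_multiples (A # As) = multiples A \<union> (- multiples A \<inter> union_of_multiples As)"
    by (auto simp: union_of_multiples_def)
  then show ?thesis using partitionable_Un[OF 1 2] by auto
qed

text \<open>The word of every exponent in the union is nonzero and of odd length, so it has exactly
  one cyclic tiling. The partition separates straight tilings from wrapping ones.\<close>

lemma partitionable_odd:
  fixes As :: "'n::finite set list"
  assumes "disjoint_blocks As" and "{} \<notin> set As" and "length As = 2 * h + 1"
  shows "partitionable (\<Union>(set As)) (union_of_multiples As) ((\<Sum>A\<leftarrow>As. card A) + 1 choose h)"
proof (cases h)
  case 0
  then obtain A where "As = [A]" using assms(3) by (cases As) auto
  then show ?thesis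
    using partitionable_multiples[of A] 0 by (simp add: union_of_multiples_def)
next
  case (Suc g)
  then obtain A Bs' where "As = A # Bs'" using assms(3) by (cases As) auto
  moreover then obtain Bs E where "Bs' = Bs @ [E]"
    using assms(3) Suc by (cases Bs' rule: rev_cases) auto
  ultimately have As: "As = A # Bs @ [E]" by simp
  have len: "length Bs = 2 * g + 1" using assms(3) Suc by (simp add: As)
  have disj: "disjoint_blocks Bs" "\<Union>(set Bs) \<inter> E = {}"
    using assms(1) by (auto simp: As sorted_wrt_append)
  \<comment> \<open>The wrapping tile: the product of \<open>E\<close> does not divide, the letter
    of \<open>A\<close> is arbitrary, and the word of \<open>Bs\<close> in between has a straight
    tiling.\<close>
  have 1: "partitionable (\<Union>(set As)) (- multiples E \<inter> tileable_exponents Bs)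
      (card E * tiling_weight (map card Bs))"
    by (rule partitionable_mono[OF partitionable_Int[OF partitionable_nonmultiples[of E]
            partitionable_tileable[OF disj(1)]]])
      (use disj in \<open>auto simp: As\<close>)
  note 2 = partitionable_Un[OF partitionable_tileable[OF assms(1)] 1]
  have word: "e \<in> union_of_multiples As \<longleftrightarrow> True \<in> set (map (\<lambda>A. A \<subseteq> Poly_Mapping.keys e) As)" for e
    by (auto simp: union_of_multiples_def multiples_def)
  have "union_of_multiples As = tileable_exponents As \<union> (- multiples E \<inter> tileable_exponents Bs)"
  proof (rule set_eqI)
    fix e
    show "e \<in> union_of_multiples As \<longleftrightarrow>
        e \<in> tileable_exponents As \<union> (- multiples E \<inter> tileable_exponents Bs)"
      unfolding word
      using cyclic_tiling(1)[of "map (\<lambda>A. A \<subseteq> Poly_Mapping.keys e) Bs" "A \<subseteq> Poly_Mapping.keys e" "E \<subseteq> Poly_Mapping.keys e"] len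
      by (simp add: As tileable_exponents_def multiples_def)
  qed
  moreover have "tileable_exponents As \<inter> (- multiples E \<inter> tileable_exponents Bs) = {}"
    using cyclic_tiling(2)[of "map (\<lambda>A. A \<subseteq> Poly_Mapping.keys e) Bs" "A \<subseteq> Poly_Mapping.keys e" "E \<subseteq> Poly_Mapping.keys e" for e] len
    by (auto simp: As tileable_exponents_def multiples_def)
  moreover have "tiling_weight (map card As) + card E * tiling_weight (map card Bs)
      \<le> (\<Sum>A\<leftarrow>As. card A) + 1 choose h"
  proof -
    have "\<forall>x\<in>set (map card As). 1 \<le> x"
      using assms(2) by (auto simp: Suc_le_eq card_gt_0_iff)
    then show ?thesis
      using cyclic_tiling_weight_le_binomial[of "map card Bs" g "card A" "card E"] len
      by (simp add: As Suc)
  qed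
  ultimately show ?thesis
    using 2 by (auto intro: partitionable_mono)
qed

lemma partitionable_even:
  fixes As :: "'n::finite set list"
  assumes "disjoint_blocks As" and "{} \<notin> set As" and "length As = 2 * h"
  shows "partitionable (\<Union>(set As)) (union_of_multiples As) ((\<Sum>A\<leftarrow>As. card A) + 1 choose h)"
proof (cases h)
  case 0
  then show ?thesis
    using assms(3)
    by (auto simp: union_of_multiples_def intro: partitionable_mono[OF partitionable_empty])
next
  case (Suc g)
  then obtain A Bs where As: "As = A # Bs" using assms(3) by (cases As) auto
  let ?s = "(\<Sum>A\<leftarrow>Bs. card A) + 1"
  have len: "length Bs = 2 * g + 1" using assms(3) Suc by (simp add: As)
  have "partitionable (\<Union>(set Bs)) (union_of_multiples Bs) (?s choose g)"
    using assms len by (intro partitionable_odd) (auto simp: As)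
  then have "partitionable (\<Union>(set As)) (union_of_multiples As) (1 + card A * (?s choose g))"
    using assms(1) unfolding As by (intro partitionable_Cons)
  moreover have "length Bs \<le> (\<Sum>A\<leftarrow>Bs. card A)"
  proof -
    have "\<forall>A\<in>set Bs. 1 \<le> card A"
      using assms(2) by (auto simp: As Suc_le_eq card_gt_0_iff)
    then show ?thesis
      using sum_list_mono[of Bs "\<lambda>_. 1" card] by (simp add: sum_list_triv)
  qed
  \<comment> \<open>This coefficient pays for the one cylinder of \<open>multiples A\<close>; it is
    positive since \<open>?s\<close> is at least \<open>2 * g + 2\<close>.\<close>
  then have "1 \<le> ?s choose Suc g"
    using len by (simp add: Suc_le_eq)
  then have "1 + card A * (?s choose g) \<le> (\<Sum>A\<leftarrow>As. card A) + 1 choose h"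
    using binomial_add_ge[of ?s g "card A"] by (simp add: As Suc algebra_simps)
  ultimately show ?thesis by (auto intro: partitionable_mono)
qed

lemma partitionable_union_of_multiples:
  fixes As :: "'n::finite set list"
  assumes "disjoint_blocks As" and "{} \<notin> set As"
  shows "partitionable (\<Union>(set As)) (union_of_multiples As)
    ((\<Sum>A\<leftarrow>As. card A) + 1 choose (length As div 2))"
  using assms partitionable_even[of As "length As div 2"] partitionable_odd[of As "length As div 2"]
  by (cases "even (length As)") auto

text \<open>For \<open>card A = 1\<close> the step \<open>partitionable_Cons\<close> adds 1 without
  multiplying the remaining count. This yields the summand \<open>k\<close> of the theorem.\<close>

lemma partitionable_prepend_singletons:
  fixes As :: "'n::finite set list"
  assumes "disjoint_blocks (Ss @ As)" and "\<forall>A\<in>set Ss. card A = 1"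
    and "partitionable (\<Union>(set As)) (union_of_multiples As) r"
  shows "partitionable (\<Union>(set (Ss @ As))) (union_of_multiples (Ss @ As)) (length Ss + r)"
  using assms
proof (induction Ss)
  case (Cons A Ss)
  then show ?case using partitionable_Cons[of A "Ss @ As" "length Ss + r"] by auto
qed simp

section \<open>Stanley decompositions of monomial ideals\<close>

lemma times_monomial_eq_sum:
  fixes f :: "('n, 'k::field) mpoly"
  shows "f * Poly_Mapping.single b 1 =
    (\<Sum>a\<in>Poly_Mapping.keys f. Poly_Mapping.single (a + b) (Poly_Mapping.lookup f a))"
  by (subst poly_eq_sum_single[of f]) (simp add: sum_distrib_right mult_single)

lemma lookup_times_monomial:
  fixes f :: "('n, 'k::field) mpoly"
  shows "Poly_Mapping.lookup (f * Poly_Mapping.single b 1) (a + b) = Poly_Mapping.lookup f a"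
  by (auto simp: times_monomial_eq_sum lookup_sum lookup_single when_def in_keys_iff)

lemma keys_times_monomial:
  fixes f :: "('n, 'k::field) mpoly"
  shows "Poly_Mapping.keys (f * Poly_Mapping.single b 1) = (\<lambda>a. a + b) ` Poly_Mapping.keys f"
proof
  show "Poly_Mapping.keys (f * Poly_Mapping.single b 1) \<subseteq> (\<lambda>a. a + b) ` Poly_Mapping.keys f"
    using keys_mult[of f "Poly_Mapping.single b 1"] by auto
  show "(\<lambda>a. a + b) ` Poly_Mapping.keys f \<subseteq> Poly_Mapping.keys (f * Poly_Mapping.single b 1)"
    by (auto simp: in_keys_iff lookup_times_monomial)
qed

lemma exponent_diff_add:
  fixes b e :: "'n \<Rightarrow>\<^sub>0 nat"
  assumes "\<And>i. Poly_Mapping.lookup b i \<le> Poly_Mapping.lookup e i"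
  shows "e - b + b = e"
  by (rule poly_mapping_eqI) (simp add: lookup_add lookup_minus assms)

text \<open>This translates Stanley spaces generated by monomials into cylinders: multiplication by
  a monomial translates the support.\<close>

lemma monomial_times_polys_in:
  "(\<lambda>f. f * Poly_Mapping.single b 1) ` K[Z] =
    {g :: ('n, 'k::field) mpoly. Poly_Mapping.keys g \<subseteq> cylinder b Z}"
proof (intro equalityI subsetI)
  fix g :: "('n, 'k) mpoly" assume "g \<in> (\<lambda>f. f * Poly_Mapping.single b 1) ` K[Z]"
  then obtain f where f: "f \<in> K[Z]" "g = f * Poly_Mapping.single b 1" by blast
  have "a + b \<in> cylinder b Z" if "a \<in> Poly_Mapping.keys f" for a
    using f(1) that by (auto simp: polys_in_def cylinder_def lookup_add in_keys_iff subset_iff)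
  then show "g \<in> {g. Poly_Mapping.keys g \<subseteq> cylinder b Z}"
    by (auto simp: f(2) keys_times_monomial)
next
  fix g :: "('n, 'k) mpoly" assume "g \<in> {g. Poly_Mapping.keys g \<subseteq> cylinder b Z}"
  then have g: "Poly_Mapping.keys g \<subseteq> cylinder b Z" by simp
  \<comment> \<open>The termwise quotient of \<open>g\<close> by the monomial; the truncated
    subtraction is exact on the cylinder.\<close>
  define f where "f = (\<Sum>e\<in>Poly_Mapping.keys g. Poly_Mapping.single (e - b) (Poly_Mapping.lookup g e))"
  have "e - b + b = e" if "e \<in> Poly_Mapping.keys g" for e
    using g that by (intro exponent_diff_add) (auto simp: cylinder_def)
  then have "f * Poly_Mapping.single b 1 =
      (\<Sum>e\<in>Poly_Mapping.keys g. Poly_Mapping.single e (Poly_Mapping.lookup g e))"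
    by (simp add: f_def sum_distrib_right mult_single)
  then have "f * Poly_Mapping.single b 1 = g"
    by (simp flip: poly_eq_sum_single)
  moreover have "Poly_Mapping.keys (e - b) \<subseteq> Z" if "e \<in> Poly_Mapping.keys g" for e
  proof
    fix x assume "x \<in> Poly_Mapping.keys (e - b)"
    then have "Poly_Mapping.lookup e x \<noteq> Poly_Mapping.lookup b x"
      by (auto simp: in_keys_iff lookup_minus)
    moreover have "e \<in> cylinder b Z" using g that by blast
    ultimately show "x \<in> Z" by (auto simp: cylinder_def)
  qed
  then have "f \<in> K[Z]"
    using keys_sum[of "\<lambda>e. Poly_Mapping.single (e - b) (Poly_Mapping.lookup g e)" "Poly_Mapping.keys g"]
    by (fastforce simp: f_def polys_in_def split: if_splits)
  ultimately show "g \<in> (\<lambda>f. f * Poly_Mapping.single b 1) ` K[Z]" by blast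
qed

text \<open>Every coefficient of a sum comes from the only summand whose support may contain that
  exponent, so the summands can be read off.\<close>

lemma direct_sum_of_disjoint_supports:
  fixes C :: "'i \<Rightarrow> 'a set"
  assumes "finite J" and "disjoint_family_on C J"
  shows "direct_sum_of J (\<lambda>i. {f :: 'a \<Rightarrow>\<^sub>0 'k::field. Poly_Mapping.keys f \<subseteq> C i})
    {f. Poly_Mapping.keys f \<subseteq> (\<Union>i\<in>J. C i)}"
proof -
  define Y where "Y = {y :: 'i \<Rightarrow> 'a \<Rightarrow>\<^sub>0 'k. (\<forall>i\<in>J. y i \<in> {f. Poly_Mapping.keys f \<subseteq> C i}) \<and>
    (\<forall>i. i \<notin> J \<longrightarrow> y i = 0) \<and> finite {i. y i \<noteq> 0}}"
  define S where "S y = (\<Sum>i | y i \<noteq> 0. y i)" for y :: "'i \<Rightarrow> 'a \<Rightarrow>\<^sub>0 'k"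
  have S: "Poly_Mapping.lookup (S y) e = (\<Sum>i\<in>J. Poly_Mapping.lookup (y i) e)" if "y \<in> Y" for y e
    unfolding S_def lookup_sum
    by (rule sum.mono_neutral_left) (use that assms(1) in \<open>auto simp: Y_def\<close>)
  have off: "Poly_Mapping.lookup (y i) e = 0" if "y \<in> Y" "i \<in> J" "e \<notin> C i" for y i e
    using that by (auto simp: Y_def simp flip: not_in_keys_iff_lookup_eq_zero)
  have S_eq: "Poly_Mapping.lookup (S y) e = Poly_Mapping.lookup (y j) e"
    if y: "y \<in> Y" and j: "j \<in> J" "e \<in> C j" for y j e
  proof -
    have "Poly_Mapping.lookup (y i) e = 0" if "i \<in> J - {j}" for i
      using disjoint_family_onD[OF assms(2), of i j] that j by (intro off[OF y]) auto
    then show ?thesis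
      using j(1) assms(1) by (simp add: S[OF y] sum.remove)
  qed
  have "inj_on S Y"
  proof (rule inj_onI, rule ext)
    fix y z i assume yz: "y \<in> Y" "z \<in> Y" "S y = S z"
    show "y i = z i"
    proof (cases "i \<in> J")
      case True
      show ?thesis
      proof (rule poly_mapping_eqI)
        fix e
        show "Poly_Mapping.lookup (y i) e = Poly_Mapping.lookup (z i) e"
          using S_eq[OF yz(1) True] S_eq[OF yz(2) True] off[OF yz(1) True] off[OF yz(2) True] yz(3)
          by (cases "e \<in> C i") auto
      qed
    qed (use yz in \<open>auto simp: Y_def\<close>)
  qed
  moreover have "Poly_Mapping.keys (S y) \<subseteq> (\<Union>i\<in>J. C i)" if "y \<in> Y" for y
  proof
    fix e assume "e \<in> Poly_Mapping.keys (S y)"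
    then have "(\<Sum>i\<in>J. Poly_Mapping.lookup (y i) e) \<noteq> 0"
      by (simp add: in_keys_iff S[OF that])
    then obtain i where "i \<in> J" "Poly_Mapping.lookup (y i) e \<noteq> 0"
      by (rule sum.not_neutral_contains_not_neutral)
    then show "e \<in> (\<Union>i\<in>J. C i)"
      using off[OF that] by auto
  qed
  moreover have "f \<in> S ` Y" if f: "Poly_Mapping.keys f \<subseteq> (\<Union>i\<in>J. C i)" for f
  proof -
    \<comment> \<open>The restriction of \<open>f\<close> to the exponents in \<open>C i\<close>;
      families in \<open>direct_sum_of\<close> must vanish outside \<open>J\<close>.\<close>
    define y where "y i = (if i \<in> J
      then \<Sum>e\<in>Poly_Mapping.keys f \<inter> C i. Poly_Mapping.single e (Poly_Mapping.lookup f e) else 0)" for i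
    have ly: "Poly_Mapping.lookup (y i) e = (if i \<in> J \<and> e \<in> C i then Poly_Mapping.lookup f e else 0)" for i e
      by (auto simp: y_def lookup_sum lookup_single when_def in_keys_iff)
    have "y i = 0" if "i \<notin> J" for i
      using that by (simp add: y_def)
    moreover from this have "finite {i. y i \<noteq> 0}"
      by (intro finite_subset[OF _ assms(1)]) blast
    moreover have "Poly_Mapping.keys (y i) \<subseteq> C i" for i
      by (rule subsetI) (simp add: in_keys_iff ly split: if_splits)
    ultimately have y: "y \<in> Y"
      by (simp add: Y_def)
    have "f = S y"
    proof (rule poly_mapping_eqI)
      fix e
      show "Poly_Mapping.lookup f e = Poly_Mapping.lookup (S y) e"
      proof (cases "\<exists>j\<in>J. e \<in> C j")
        case True
        then show ?thesis using S_eq[OF y] by (auto simp: ly)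
      next
        case False
        then have "Poly_Mapping.lookup f e = 0" using f by (auto simp: in_keys_iff)
        moreover from this have "Poly_Mapping.lookup (y i) e = 0" for i by (simp add: ly)
        ultimately show ?thesis using S[OF y, of e] by simp
      qed
    qed
    with y show ?thesis by blast
  qed
  ultimately have "bij_betw S Y {f. Poly_Mapping.keys f \<subseteq> (\<Union>i\<in>J. C i)}"
    unfolding bij_betw_def by blast
  then show ?thesis
    by (simp add: direct_sum_of_def S_def[abs_def] Y_def)
qed

section \<open>Monomial ideals as sets of exponents\<close>

definition exponents_above :: "('n, 'k::field) mpoly set \<Rightarrow> ('n \<Rightarrow>\<^sub>0 nat) set"
  where "exponents_above U = {b + c | b c. Poly_Mapping.single b 1 \<in> U}"

text \<open>A monomial ideal is spanned over the field by its monomials, so membership is a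
  condition on the support alone.\<close>

lemma ideal_eq_supported_above:
  fixes U :: "('n, 'k::field) mpoly set"
  assumes "U \<subseteq> monomials"
  shows "ideal U = {f. Poly_Mapping.keys f \<subseteq> exponents_above U}"
proof (intro equalityI subsetI)
  fix f assume "f \<in> ideal U"
  then have "Poly_Mapping.keys f \<subseteq> exponents_above U"
  proof (induction rule: poly_module.span_induct_alt)
    case (step c x y)
    obtain b where x: "x = Poly_Mapping.single b 1"
      using step(1) assms by (auto simp: monomials_def)
    have "a + b \<in> exponents_above U" for a
      using step(1) unfolding x exponents_above_def 
      by (intro CollectI exI[of _ b] exI[of _ a]) (simp add: add.commute)
    then have "Poly_Mapping.keys (c * x) \<subseteq> exponents_above U"
      unfolding x keys_times_monomial by blast
    then show ?case using step(2) keys_add[of "c * x" y] by blast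
  qed simp
  then show "f \<in> {f. Poly_Mapping.keys f \<subseteq> exponents_above U}" by simp
next
  fix f :: "('n, 'k) mpoly" assume f: "f \<in> {f. Poly_Mapping.keys f \<subseteq> exponents_above U}"
  have "Poly_Mapping.single e a \<in> ideal U" if "e \<in> exponents_above U" for e a
  proof -
    obtain b c where bc: "e = b + c" "Poly_Mapping.single b 1 \<in> U"
      using \<open>e \<in> exponents_above U\<close> by (auto simp: exponents_above_def)
    then have "Poly_Mapping.single e a = Poly_Mapping.single c a * Poly_Mapping.single b 1"
      by (simp add: mult_single add.commute)
    then show ?thesis
      using bc(2) by (simp add: poly_module.span_scale poly_module.span_base)
  qed
  then have "(\<Sum>b\<in>Poly_Mapping.keys f. Poly_Mapping.single b (Poly_Mapping.lookup f b)) \<in> ideal U"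
    using f by (intro poly_module.span_sum) auto
  then show "f \<in> ideal U"
    by (simp flip: poly_eq_sum_single)
qed

lemma monomial_in_ideal_iff:
  assumes "U \<subseteq> monomials"
  shows "Poly_Mapping.single e (1 :: 'k::field) \<in> ideal U \<longleftrightarrow>
    (\<exists>b c. e = b + c \<and> Poly_Mapping.single b 1 \<in> U)"
  by (auto simp: ideal_eq_supported_above[OF assms] exponents_above_def)

text \<open>Each cylinder of the partition becomes one summand x^b K[Z]; disjointness of the
  cylinders makes the sum direct.\<close>

lemma ideal_slength_le:
  fixes U :: "('n::finite, 'k::field) mpoly set"
  assumes U: "U \<subseteq> monomials" "finite U" and part: "partitionable V (exponents_above U) r"
  shows "ideal_slength (ideal U) \<le> r"
proof -
  interpret gm: graded_module "(*)" "ideal U" "graded_part (ideal U)"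
    by (rule graded_module_monomial_ideal[OF U])
  obtain D where D: "finite D" "card D \<le> r" "disjoint_family_on (\<lambda>(b, Z). cylinder b Z) D"
    "(\<Union>(b, Z)\<in>D. cylinder b Z) = exponents_above U"
    using part unfolding partitionable_def by blast
  obtain L where L: "set L = D" "distinct L"
    using finite_distinct_list[OF D(1)] by blast
  define E :: "(('n, 'k) mpoly \<times> 'n set) list"
    where "E = map (\<lambda>(b, Z). (Poly_Mapping.single b 1, Z)) L"
  have space: "gm.stanley_space (fst (E ! i)) (snd (E ! i)) =
      {g. Poly_Mapping.keys g \<subseteq> (case L ! i of (b, Z) \<Rightarrow> cylinder b Z)}" if "i < length L" for i
    using that by (simp add: gm.stanley_space_def E_def monomial_times_polys_in split: prod.split)
  \<comment> \<open>The pieces are now indexed by positions in \<open>L\<close>; distinctness of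
    \<open>L\<close> makes different positions carry different cylinders.\<close>
  have "disjoint_family_on (\<lambda>i. case L ! i of (b, Z) \<Rightarrow> cylinder b Z) {..<length L}"
    unfolding disjoint_family_on_def
  proof (intro ballI impI)
    fix i j assume ij: "i \<in> {..<length L}" "j \<in> {..<length L}" "i \<noteq> j"
    then show "(case L ! i of (b, Z) \<Rightarrow> cylinder b Z) \<inter> (case L ! j of (b, Z) \<Rightarrow> cylinder b Z) = {}"
      using L by (intro disjoint_family_onD[OF D(3)]) (auto simp: nth_eq_iff_index_eq)
  qed
  from direct_sum_of_disjoint_supports[OF _ this, where 'k = 'k]
  have "direct_sum_of {..<length L}
      (\<lambda>i. {g :: ('n, 'k) mpoly. Poly_Mapping.keys g \<subseteq> (case L ! i of (b, Z) \<Rightarrow> cylinder b Z)})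
      {g. Poly_Mapping.keys g \<subseteq> (\<Union>i<length L. case L ! i of (b, Z) \<Rightarrow> cylinder b Z)}"
    by simp
  moreover have "(\<Union>i<length L. case L ! i of (b, Z) \<Rightarrow> cylinder b Z) = exponents_above U"
    unfolding D(4)[symmetric] L(1)[symmetric] by (force simp: set_conv_nth)
  ultimately have "direct_sum_of {..<length L}
      (\<lambda>i. {g. Poly_Mapping.keys g \<subseteq> (case L ! i of (b, Z) \<Rightarrow> cylinder b Z)}) (ideal U)"
    unfolding ideal_eq_supported_above[OF U(1)] by simp
  then have "direct_sum_of {..<length L}
      (\<lambda>i. gm.stanley_space (fst (E ! i)) (snd (E ! i))) (ideal U)"
    unfolding direct_sum_of_def by (simp add: space)
  then have "direct_sum_of {..<length E}
      (\<lambda>i. gm.stanley_space (fst (E ! i)) (snd (E ! i))) (ideal U)"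
    by (simp add: E_def)
  moreover have "v \<in> ideal U \<and> (\<exists>a. v \<in> graded_part (ideal U) a) \<and> inj_on (\<lambda>f. f * v) K[Z]"
    if vZ: "(v, Z) \<in> set E" for v Z
  proof -
    obtain b where b: "(b, Z) \<in> D" "v = Poly_Mapping.single b 1"
      using vZ L(1) by (auto simp: E_def)
    have "b \<in> exponents_above U" using b(1) D(4) cylinder_self by blast
    then have v: "v \<in> ideal U" by (simp add: b(2) ideal_eq_supported_above[OF U(1)])
    moreover have "v \<in> graded_part (ideal U) (zdeg b)"
      using v by (simp add: graded_part_def b(2))
    moreover have "inj_on (\<lambda>f. f * v) K[Z]"
      unfolding b(2) by (rule inj_onI) (metis lookup_times_monomial poly_mapping_eqI)
    ultimately show ?thesis by blast
  qed
  ultimately have "gm.stanley_decomposition E"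
    unfolding gm.stanley_decomposition_def by blast
  then have "gm.slength \<le> length E"
    unfolding gm.slength_def by (intro Least_le) blast
  also have "length E \<le> r"
    using D(2) distinct_card[OF L(2)] by (simp add: E_def L(1))
  finally show ?thesis by (simp add: ideal_slength_def)
qed

section \<open>Squarefree complete intersections\<close>

lemma single_one_eq_iff:
  "Poly_Mapping.single a (1 :: 'k::field) = Poly_Mapping.single b 1 \<longleftrightarrow> a = b"
proof
  assume "Poly_Mapping.single a (1 :: 'k) = Poly_Mapping.single b 1"
  from arg_cong[OF this, of Poly_Mapping.keys] show "a = b" by simp
qed simp

text \<open>Otherwise the generator with exponent \<open>b + c\<close> would be a multiple of
  another one and could be dropped.\<close>

lemma minimal_generator_unique_divisor:
  fixes U :: "('n, 'k::field) mpoly set"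
  assumes U: "minimal_monomial_generators U I"
    and "Poly_Mapping.single (b + c) 1 \<in> U" and "Poly_Mapping.single b 1 \<in> U"
  shows "c = 0"
proof (rule ccontr)
  assume "c \<noteq> 0"
  let ?u = "Poly_Mapping.single (b + c) 1 :: ('n, 'k) mpoly"
  have "Poly_Mapping.single b 1 \<noteq> ?u"
    using \<open>c \<noteq> 0\<close> by (auto simp: single_one_eq_iff)
  then have "Poly_Mapping.single b 1 \<in> U - {?u}" using assms(3) by blast
  then have "Poly_Mapping.single c 1 * Poly_Mapping.single b 1 \<in> ideal (U - {?u})"
    by (intro poly_module.span_scale poly_module.span_base)
  then have "?u \<in> ideal (U - {?u})" by (simp add: mult_single add.commute)
  then have "U \<subseteq> ideal (U - {?u})"
    using poly_module.span_superset[of "U - {?u}"] by blast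
  moreover have "U - {?u} \<subseteq> ideal U"
    using poly_module.span_superset[of U] by blast
  ultimately have "ideal (U - {?u}) = ideal U"
    unfolding poly_module.span_eq by (rule conjI[rotated])
  moreover have "U - {?u} \<subset> U" using assms(2) by blast
  ultimately show False using U unfolding minimal_monomial_generators_def by blast
qed

text \<open>A generator in \<open>U\<close> is a multiple of some \<open>v\<close> from
  \<open>V\<close>, which is a multiple of some \<open>w\<close> from \<open>U\<close>. Minimality
  of \<open>U\<close> makes all three equal.\<close>

lemma minimal_monomial_generators_subset:
  assumes U: "minimal_monomial_generators U I" and V: "minimal_monomial_generators V I"
  shows "U \<subseteq> V"
proof
  fix u assume u: "u \<in> U"
  have mon: "U \<subseteq> monomials" "V \<subseteq> monomials" and id: "ideal U = I" "ideal V = I"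
    using U V by (auto simp: minimal_monomial_generators_def)
  obtain b where b: "u = Poly_Mapping.single b 1" using u mon by (auto simp: monomials_def)
  have "u \<in> ideal V" using u id poly_module.span_base by blast
  then obtain v c where v: "b = v + c" "Poly_Mapping.single v 1 \<in> V"
    unfolding b monomial_in_ideal_iff[OF mon(2)] by blast
  have "Poly_Mapping.single v 1 \<in> ideal U" using v(2) id poly_module.span_base by blast
  then obtain w c' where w: "v = w + c'" "Poly_Mapping.single w 1 \<in> U"
    unfolding monomial_in_ideal_iff[OF mon(1)] by blast
  have "c' + c = 0"
    using minimal_generator_unique_divisor[OF U _ w(2), of "c' + c"] u
    by (simp add: b v(1) w(1) add.assoc)
  then have "c = 0" by (auto simp: poly_mapping_eq_iff fun_eq_iff lookup_add)
  then show "u \<in> V" using v by (simp add: b)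
qed

text \<open>Squarefreeness and regularity are stated for some minimal generating set; uniqueness
  transfers them to the given one.\<close>

lemma minimal_monomial_generators_unique:
  "minimal_monomial_generators U I \<Longrightarrow> minimal_monomial_generators V I \<Longrightarrow> U = V"
  by (rule subset_antisym) (erule (1) minimal_monomial_generators_subset)+

text \<open>The lcm of the two generators lies in the ideal of the earlier ones, hence by regularity
  so does the earlier generator divided by the gcd. By minimality it can only be a multiple of that
  generator itself, so the gcd is 1.\<close>

lemma regular_sequence_coprime:
  fixes us :: "('n, 'k::field) mpoly list"
  assumes "minimal_monomial_generators (set us) I" and "regular_sequence us"
    and "i < j" and "j < length us"
    and b: "us ! i = Poly_Mapping.single b 1" and c: "us ! j = Poly_Mapping.single c 1"
  shows "Poly_Mapping.keys b \<inter> Poly_Mapping.keys c = {}"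
proof -
  have mon: "set (take j us) \<subseteq> monomials"
    using assms(1) set_take_subset[of j us] unfolding minimal_monomial_generators_def
    by (meson order_trans)
  have "take j us ! i \<in> set (take j us)"
    using assms(3,4) by (intro nth_mem) simp
  then have "us ! i \<in> set (take j us)"
    using assms(3) by simp
  \<comment> \<open>Both sides are the exponent of the lcm, because subtraction of exponents is
    truncated at 0.\<close>
  moreover have "c + (b - c) = (c - b) + b"
    by (rule poly_mapping_eqI) (simp add: lookup_add lookup_minus)
  then have "us ! j * Poly_Mapping.single (b - c) 1 = Poly_Mapping.single (c - b) 1 * us ! i"
    by (simp add: b c mult_single)
  ultimately have "us ! j * Poly_Mapping.single (b - c) 1 \<in> ideal (set (take j us))"
    by (simp add: poly_module.span_scale poly_module.span_base)
  then have "Poly_Mapping.single (b - c) 1 \<in> ideal (set (take j us))"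
    using assms(2,4) unfolding regular_sequence_def by blast
  then obtain v w where vw: "b - c = v + w" "Poly_Mapping.single v 1 \<in> set (take j us)"
    unfolding monomial_in_ideal_iff[OF mon] by blast
  \<comment> \<open>The term \<open>b - (b - c)\<close> is the exponent of the gcd. Once the bracket
    is known to be 0, \<open>b\<close> and \<open>c\<close> have no common variable.\<close>
  have "b = v + (w + (b - (b - c)))"
  proof -
    have "b = (b - c) + (b - (b - c))"
      by (rule poly_mapping_eqI) (simp add: lookup_add lookup_minus)
    then show ?thesis by (metis vw(1) add.assoc)
  qed
  moreover have "Poly_Mapping.single b 1 \<in> set us"
    using assms(3,4) by (metis b nth_mem order_less_trans)
  moreover have "Poly_Mapping.single v 1 \<in> set us"
    using vw(2) by (rule in_set_takeD)
  ultimately have "w + (b - (b - c)) = 0"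
    by (intro minimal_generator_unique_divisor[OF assms(1), of v]) simp_all
  have "Poly_Mapping.lookup b x = 0 \<or> Poly_Mapping.lookup c x = 0" for x
  proof -
    have "Poly_Mapping.lookup (w + (b - (b - c))) x = 0"
      by (simp add: \<open>w + (b - (b - c)) = 0\<close>)
    then show ?thesis by (simp add: lookup_add lookup_minus) linarith
  qed
  then show ?thesis by (auto simp: in_keys_iff)
qed

text \<open>An exponent of at least 2 would make the square of a variable a divisor. Squarefreeness
  would then make the variable a unit, although it divides every term of its multiples and does not
  divide 1.\<close>

lemma squarefree_monomial_exponent_le_1:
  fixes b :: "'n \<Rightarrow>\<^sub>0 nat"
  assumes "squarefree (Poly_Mapping.single b 1 :: ('n, 'k::field) mpoly)"
  shows "Poly_Mapping.lookup b x \<le> 1"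
proof (rule ccontr)
  assume "\<not> Poly_Mapping.lookup b x \<le> 1"
  define s where "s = Poly_Mapping.single x (1 :: nat)"
  let ?X = "Poly_Mapping.single s 1 :: ('n, 'k) mpoly"
  have "b - (s + s) + (s + s) = b"
    using \<open>\<not> _\<close> by (intro exponent_diff_add) (auto simp: s_def lookup_add lookup_single when_def)
  then have "Poly_Mapping.single b 1 = ?X\<^sup>2 * Poly_Mapping.single (b - (s + s)) 1"
    by (simp add: power2_eq_square mult_single add.commute)
  then have "?X\<^sup>2 dvd Poly_Mapping.single b 1" by (metis dvd_triv_left)
  then have "?X dvd 1" using assms unfolding squarefree_def by blast
  then obtain q where "1 = q * ?X" by (metis dvdE mult.commute)
  then have "0 \<in> (\<lambda>a. a + s) ` Poly_Mapping.keys q"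
    using keys_times_monomial[of q s] by (metis keys_one singletonI)
  then obtain a where "0 = a + s" by blast
  then have "0 = Poly_Mapping.lookup a x + 1"
    using lookup_add[of a s x] by (simp add: s_def)
  then show False by simp
qed

lemma total_degree_squarefree_monomial:
  fixes b :: "'n::finite \<Rightarrow>\<^sub>0 nat"
  assumes "\<And>x. Poly_Mapping.lookup b x \<le> 1"
  shows "total_degree (Poly_Mapping.single b 1 :: ('n, 'k::field) mpoly) = card (Poly_Mapping.keys b)"
proof -
  have "(\<Sum>i\<in>UNIV. Poly_Mapping.lookup b i) = (\<Sum>i\<in>Poly_Mapping.keys b. Poly_Mapping.lookup b i)"
    by (rule sum.mono_neutral_right) (auto simp: in_keys_iff)
  also have "\<dots> = (\<Sum>i\<in>Poly_Mapping.keys b. 1)"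
    using assms by (intro sum.cong) (simp_all add: in_keys_iff le_antisym Suc_le_eq)
  finally show ?thesis by (simp add: total_degree_def)
qed

text \<open>With exponents at most 1, divisibility amounts to inclusion of supports.\<close>

lemma exponents_above_squarefree:
  assumes "\<And>i x. i \<in> J \<Longrightarrow> Poly_Mapping.lookup (b i) x \<le> 1"
  shows "exponents_above ((\<lambda>i. Poly_Mapping.single (b i) (1 :: 'k::field)) ` J) =
    (\<Union>i\<in>J. multiples (Poly_Mapping.keys (b i)))"
proof -
  have "(\<exists>c. e = b i + c) \<longleftrightarrow> Poly_Mapping.keys (b i) \<subseteq> Poly_Mapping.keys e" if "i \<in> J" for i e
  proof
    assume "Poly_Mapping.keys (b i) \<subseteq> Poly_Mapping.keys e"
    then have "Poly_Mapping.lookup (b i) x \<le> Poly_Mapping.lookup e x" for x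
      using assms[OF that, of x] subsetD[OF \<open>_ \<subseteq> _\<close>, of x]
      by (cases "x \<in> Poly_Mapping.keys (b i)") (auto simp: in_keys_iff)
    then show "\<exists>c. e = b i + c" by (metis exponent_diff_add add.commute)
  qed (auto simp: in_keys_iff lookup_add)
  moreover have "exponents_above ((\<lambda>i. Poly_Mapping.single (b i) (1 :: 'k)) ` J) =
      {e. \<exists>i\<in>J. \<exists>c. e = b i + c}"
    by (auto simp: exponents_above_def image_iff single_one_eq_iff)
  ultimately show ?thesis by (auto simp: multiples_def)
qed

theorem theorem4p6:
  fixes I :: "('n::finite, 'k::field) mpoly set"
    and u :: "nat \<Rightarrow> ('n, 'k) mpoly"
    and d :: "nat \<Rightarrow> nat"
    and m k n' :: nat
  assumes "squarefree_monomial_ideal I"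
    and "complete_intersection_monomial_ideal I"
    and "inj_on u {1..m}"
    and "minimal_monomial_generators (u ` {1..m}) I"
    and "\<forall>i\<in>{1..m}. d i = total_degree (u i)"
    and "k \<le> m"
    and "\<forall>i\<in>{1..k}. d i = 1"
    and "k < m \<longrightarrow> 1 < d (k + 1)"
    and "\<forall>i\<in>{k+1..<m}. d i \<le> d (i + 1)"
    and "n' = (\<Sum>i=k+1..m. d i)"
  shows "ideal_slength I \<le> k + ((n' + 1) choose ((m - k) div 2)) \<and>
    (k = 0 \<and> n' = CARD('n) \<longrightarrow> ideal_slength I \<le> ((CARD('n) + 1) choose (m div 2)))"
proof -
  have mon: "u ` {1..m} \<subseteq> monomials" and I: "ideal (u ` {1..m}) = I"
    using assms(4) by (auto simp: minimal_monomial_generators_def)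
  have "\<forall>i\<in>{1..m}. \<exists>b. u i = Poly_Mapping.single b 1"
    using mon by (auto simp: monomials_def)
  then obtain b where b: "\<And>i. i \<in> {1..m} \<Longrightarrow> u i = Poly_Mapping.single (b i) 1"
    by metis
  define A where "A i = Poly_Mapping.keys (b i)" for i
  have "\<forall>v\<in>u ` {1..m}. squarefree v"
    using assms(1) minimal_monomial_generators_unique[OF _ assms(4)]
    unfolding squarefree_monomial_ideal_def by blast
  then have le1: "Poly_Mapping.lookup (b i) x \<le> 1" if "i \<in> {1..m}" for i x
    using that b by (intro squarefree_monomial_exponent_le_1[where 'k = 'k]) force
  have card_A: "card (A i) = d i" if "i \<in> {1..m}" for i
    using assms(5) b total_degree_squarefree_monomial[OF le1, where 'k = 'k] that by (simp add: A_def)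
  have disj: "A i \<inter> A j = {}" if ij: "i \<in> {1..m}" "j \<in> {1..m}" "i < j" for i j
  proof -
    obtain us where us: "minimal_monomial_generators (set us) I" "regular_sequence us"
      using assms(2) unfolding complete_intersection_monomial_ideal_def by blast
    \<comment> \<open>The regular sequence may list the generators in another order, so both orders
      of the positions \<open>p\<close> and \<open>q\<close> are considered.\<close>
    have "u i \<in> set us" "u j \<in> set us"
      using minimal_monomial_generators_unique[OF us(1) assms(4)] ij by auto
    then obtain p q where pq: "p < length us" "us ! p = u i" "q < length us" "us ! q = u j"
      by (auto simp: in_set_conv_nth)
    have "p \<noteq> q" using pq ij inj_onD[OF assms(3)] by fastforce
    then consider "p < q" | "q < p" by linarith
    then show ?thesis
    proof cases
      case 1
      then show ?thesis unfolding A_def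
        by (rule regular_sequence_coprime[OF us]) (use pq b ij in auto)
    next
      case 2
      then have "A j \<inter> A i = {}" unfolding A_def
        by (rule regular_sequence_coprime[OF us]) (use pq b ij in auto)
      then show ?thesis by blast
    qed
  qed
  \<comment> \<open>The degrees increase weakly from index \<open>k + 1\<close> on, where the degree
    exceeds 1. Hence the blocks in \<open>As\<close> below are nonempty.\<close>
  have pos: "1 < d i" if "k + 1 \<le> i" "i \<le> m" for i
    using that
  proof (induction i rule: dec_induct)
    case base
    then show ?case using assms(8) by simp
  next
    case (step i)
    then show ?case using bspec[OF assms(9), of i] by simp
  qed
  \<comment> \<open>The generators of degree 1 give the singleton blocks in \<open>Ss\<close>; the
    binomial bound is applied only to the blocks in \<open>As\<close>.\<close>
  define Ss where "Ss = map A [1..<Suc k]"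
  define As where "As = map A [Suc k..<Suc m]"
  have split: "Ss @ As = map A [1..<Suc m]"
    using upt_add_eq_append[of 1 "Suc k" "m - k"] assms(6)
    by (simp add: Ss_def As_def del: upt_Suc)
  have "disjoint_blocks (Ss @ As)"
    unfolding split sorted_wrt_map
    by (rule sorted_wrt_mono_rel[OF _ sorted_wrt_upt], rule disj) auto
  moreover have "{} \<notin> set As"
  proof -
    have "{} \<noteq> A i" if "Suc k \<le> i" "i \<le> m" for i
      using card_A[of i] pos[of i] that by fastforce
    then show ?thesis by (auto simp: As_def image_iff less_Suc_eq_le simp del: upt_Suc)
  qed
  moreover have "\<forall>A\<in>set Ss. card A = 1"
    using assms(6,7) by (simp add: Ss_def card_A del: upt_Suc)
  moreover have "(\<Sum>A\<leftarrow>As. card A) = n'"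
  proof -
    have "(\<Sum>A\<leftarrow>As. card A) = (\<Sum>i\<in>{Suc k..<Suc m}. card (A i))"
      by (simp add: As_def comp_def interv_sum_list_conv_sum_set_nat del: upt_Suc)
    also have "\<dots> = n'"
      unfolding assms(10) by (rule sum.cong) (auto simp: card_A)
    finally show ?thesis .
  qed
  ultimately have "partitionable (\<Union>(set (Ss @ As))) (union_of_multiples (Ss @ As))
      (length Ss + (n' + 1 choose (length As div 2)))"
    using partitionable_union_of_multiples[of As]
    by (intro partitionable_prepend_singletons) (auto simp: sorted_wrt_append)
  moreover have "union_of_multiples (Ss @ As) = exponents_above (u ` {1..m})"
  proof -
    have "u ` {1..m} = (\<lambda>i. Poly_Mapping.single (b i) 1) ` {1..m}"
      using b by (intro image_cong) auto
    then show ?thesis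
      using exponents_above_squarefree[of "{1..m}" b, where 'k = 'k] le1
      by (auto simp: split union_of_multiples_def A_def atLeastLessThanSuc_atLeastAtMost simp del: upt_Suc)
  qed
  ultimately have "ideal_slength I \<le> length Ss + (n' + 1 choose (length As div 2))"
    using ideal_slength_le[OF mon] I by auto
  then have "ideal_slength I \<le> k + ((n' + 1) choose ((m - k) div 2))"
    by (simp add: Ss_def As_def del: upt_Suc)
  then show ?thesis by auto
qed

end
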